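(* Let $G$ be a graph with $n$ vertices and $m$ edges. Let $U$ be the set of isolated vertices of $G$, $W=V(G)\setminus U$ and $r=|W|$. Let $\sigma_1,\dots,\sigma_n$ be the singular values of the Randić incidence matrix $I_R(G)$, and let $I_{I_R}^1(G)$, $I_\alpha^2(G)$, $I_\alpha^3(G)$ be the generalized graph entropies formed from $\sigma_1,\dots,\sigma_n$. Then for $\alpha\ne1$: (i) $I_{I_R}^1(G)=1-\frac{r}{I_RE^2(G)}$; (ii) $I_\alpha^2(G)=\frac{1}{1-\alpha}\log\frac{M_\alpha^*}{I_RE^\alpha(G)}$; (iii) $I_\alpha^3(G)=\frac{1}{2^{1-\alpha}-1}\left(\frac{M_\alpha^*}{I_RE^\alpha(G)}-1\right)$, where $I_RE(G)$ is the Randić incidence energy of $G$, $I_RE^\alpha(G)=(I_RE(G))^\alpha$, and $M_\alpha^*=\sum_{i=1}^n|\sigma_i|^\alpha$.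
   Context: Graphs are simple, with vertex set $V(G)=\{v_1,\dots,v_n\}$, vertex degrees $d_1,\dots,d_n$ and edges $e_1,\dots,e_m$. The Randić incidence matrix $I_R(G)$ is the $n\times m$ matrix with $(i,j)$-entry $d_i^{-1/2}$ if $v_i$ is incident to $e_j$ and $0$ otherwise. Its singular values are taken to be the $n$ numbers $\sigma_1,\dots,\sigma_n$ that are the nonnegative square roots of the eigenvalues of $I_R(G)I_R(G)^T$. The Randić incidence energy is $I_RE(G)=\sum_{i=1}^n\sigma_i$. For numbers $\mu_1,\dots,\mu_n$ (listed with multiplicity), put $p_i=|\mu_i|/\sum_{j=1}^n|\mu_j|$. The generalized graph entropies formed from $\mu_1,\dots,\mu_n$ are $I^1=\sum_{i=1}^n p_i(1-p_i)$, $\quad I^2_\alpha=\frac{1}{1-\alpha}\log\left(\sum_{i=1}^n p_i^\alpha\right)$, $\quad I^3_\alpha=\frac{\sum_{i=1}^n p_i^\alpha-1}{2^{1-\alpha}-1}$ for $\alpha\ne1$, where $\log$ is the logarithm to a fixed base. The subscript on $I^1$ names the matrix used. *)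

theory Defs
  imports Complex_Main "HOL-Computational_Algebra.Polynomial"
    "Jordan_Normal_Form.Matrix" "Jordan_Normal_Form.Char_Poly"
begin

text \<open>A finite simple graph is given by the enumeration \<open>vs = [v\<^sub>1, \<dots>, v\<^sub>n]\<close> of its vertices and
  the enumeration \<open>es = [e\<^sub>1, \<dots>, e\<^sub>m]\<close> of its edges, which are two-element sets of vertices.
  The enumerations index the rows and columns of the incidence matrix.\<close>

definition simple_graph :: "'a list \<Rightarrow> 'a set list \<Rightarrow> bool" where
  "simple_graph vs es \<longleftrightarrow>
     distinct vs \<and> distinct es \<and> (\<forall>e\<in>set es. e \<subseteq> set vs \<and> card e = 2)"

definition vdegree :: "'a set list \<Rightarrow> 'a \<Rightarrow> nat" where
  "vdegree es v = card {e \<in> set es. v \<in> e}"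

definition isolated_vertices :: "'a list \<Rightarrow> 'a set list \<Rightarrow> 'a set" where
  "isolated_vertices vs es = {v \<in> set vs. vdegree es v = 0}"

definition randic_incidence_matrix :: "'a list \<Rightarrow> 'a set list \<Rightarrow> real mat" where
  "randic_incidence_matrix vs es =
     mat (length vs) (length es)
       (\<lambda>(i, j). if vs ! i \<in> es ! j then real (vdegree es (vs ! i)) powr (- 1 / 2) else 0)"

text \<open>The singular values of an \<open>n \<times> m\<close> matrix \<open>A\<close> are here the \<open>n\<close> square roots of the eigenvalues
  of \<open>A A\<^sup>T\<close>, with (algebraic) multiplicity. \<open>proots\<close> only collects the real roots of the
  characteristic polynomial; \<open>singular_values_spec\<close> below shows that none is missing.\<close>

definition singular_values :: "real mat \<Rightarrow> real multiset" where
  "singular_values A = image_mset sqrt (proots (char_poly (A * transpose_mat A)))"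

definition randic_incidence_energy :: "'a list \<Rightarrow> 'a set list \<Rightarrow> real" where
  "randic_incidence_energy vs es = sum_mset (singular_values (randic_incidence_matrix vs es))"

text \<open>The generalized graph entropies formed from \<open>\<mu> 1, \<dots>, \<mu> n\<close>; \<open>b\<close> is the base of the logarithm.
  Note that \<open>0 powr \<alpha> = 0\<close> for every \<open>\<alpha>\<close>, so that a vanishing \<open>\<mu> i\<close> contributes nothing to the
  power sums.\<close>

definition entropy_weight :: "nat \<Rightarrow> (nat \<Rightarrow> real) \<Rightarrow> nat \<Rightarrow> real" where
  "entropy_weight n \<mu> i = \<bar>\<mu> i\<bar> / (\<Sum>j=1..n. \<bar>\<mu> j\<bar>)"

definition entropy1 :: "nat \<Rightarrow> (nat \<Rightarrow> real) \<Rightarrow> real" where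
  "entropy1 n \<mu> = (\<Sum>i=1..n. entropy_weight n \<mu> i * (1 - entropy_weight n \<mu> i))"

definition entropy2 :: "real \<Rightarrow> real \<Rightarrow> nat \<Rightarrow> (nat \<Rightarrow> real) \<Rightarrow> real" where
  "entropy2 b \<alpha> n \<mu> = 1 / (1 - \<alpha>) * log b (\<Sum>i=1..n. entropy_weight n \<mu> i powr \<alpha>)"

definition entropy3 :: "real \<Rightarrow> nat \<Rightarrow> (nat \<Rightarrow> real) \<Rightarrow> real" where
  "entropy3 \<alpha> n \<mu> = ((\<Sum>i=1..n. entropy_weight n \<mu> i powr \<alpha>) - 1) / (2 powr (1 - \<alpha>) - 1)"

lemma complex_eigenvalue_gram:
  fixes A :: "real mat"
  assumes A: "A \<in> carrier_mat n m"
    and ev: "eigenvalue (map_mat complex_of_real (A * transpose_mat A)) a"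
  shows "\<exists>x\<ge>0. a = complex_of_real x"
proof -
  let ?C = "map_mat complex_of_real A"
  let ?T = "transpose_mat ?C"
  have C: "?C \<in> carrier_mat n m" and T: "?T \<in> carrier_mat m n" using A by auto
  have "map_mat complex_of_real (A * transpose_mat A)
      = ?C * map_mat complex_of_real (transpose_mat A)"
    using A by (intro of_real_hom.mat_hom_mult[where n = m]) auto
  also have "map_mat complex_of_real (transpose_mat A) = ?T" by auto
  finally have eq: "map_mat complex_of_real (A * transpose_mat A) = ?C * ?T" .
  from ev obtain v where v: "v \<in> carrier_vec n" "v \<noteq> 0\<^sub>v n"
    and Bv: "(?C * ?T) *\<^sub>v v = a \<cdot>\<^sub>v v"
    using C unfolding eigenvalue_def eigenvector_def eq by auto
  define w where "w = ?T *\<^sub>v v"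
  have w: "w \<in> carrier_vec m" unfolding w_def using T v by auto
  have cw: "conjugate w = ?T *\<^sub>v conjugate v"
    unfolding w_def using A v
    by (intro eq_vecI) (auto simp: scalar_prod_def sum_conjugate conjugate_dist_mul)
  have "w \<bullet>c w = w \<bullet> (?T *\<^sub>v conjugate v)" by (simp add: cw)
  also have "\<dots> = (?C *\<^sub>v w) \<bullet> conjugate v"
    using transpose_vec_mult_scalar[OF C, of "w" "conjugate v"] v w
    by (metis carrier_vec_conjugate comm_scalar_prod T C mult_mat_vec_carrier)
  also have "?C *\<^sub>v w = a \<cdot>\<^sub>v v"
    unfolding w_def using Bv C T v by (metis assoc_mult_mat_vec)
  also have "(a \<cdot>\<^sub>v v) \<bullet> conjugate v = a * (v \<bullet>c v)" using v by simp
  finally have main: "w \<bullet>c w = a * (v \<bullet>c v)" .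
  have pos: "v \<bullet>c v > 0" using v by simp
  have nonneg: "w \<bullet>c w \<ge> 0" by (rule conjugate_square_ge_0_vec)
  have "v \<bullet>c v = complex_of_real (Re (v \<bullet>c v))" "Re (v \<bullet>c v) > 0"
    using pos by (auto simp: less_complex_def complex_eq_iff)
  moreover have "w \<bullet>c w = complex_of_real (Re (w \<bullet>c w))" "Re (w \<bullet>c w) \<ge> 0"
    using nonneg by (auto simp: less_eq_complex_def complex_eq_iff)
  ultimately have "a = complex_of_real (Re (w \<bullet>c w) / Re (v \<bullet>c v))"
    "Re (w \<bullet>c w) / Re (v \<bullet>c v) \<ge> 0"
    using main pos
    by (auto simp: field_simps)
  then show ?thesis by blast
qed

lemma char_poly_gram_factorized:
  fixes A :: "real mat"
  assumes A: "A \<in> carrier_mat n m"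
  obtains xs where "length xs = n" "\<forall>x\<in>set xs. x \<ge> 0"
    "char_poly (A * transpose_mat A) = (\<Prod>x\<leftarrow>xs. [:- x, 1:])"
proof -
  interpret poly_hom: map_poly_inj_comm_ring_hom complex_of_real ..
  let ?B = "A * transpose_mat A"
  let ?C = "map_mat complex_of_real ?B"
  have B: "?B \<in> carrier_mat n n" and C: "?C \<in> carrier_mat n n" using A by auto
  from char_poly_factorized[OF C] obtain as where
    as: "char_poly ?C = (\<Prod>a\<leftarrow>as. [:- a, 1:])" "length as = n" by auto
  have "\<exists>x\<ge>0. a = complex_of_real x" if "a \<in> set as" for a
  proof (rule complex_eigenvalue_gram[OF A])
    show "eigenvalue ?C a"
      unfolding eigenvalue_root_char_poly[OF C] as(1) using that
      by (auto simp: poly_prod_list prod_list_zero_iff o_def image_iff)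
  qed
  then have re: "\<forall>a\<in>set as. Re a \<ge> 0 \<and> complex_of_real (Re a) = a" by fastforce
  have "map_poly complex_of_real (char_poly ?B) = (\<Prod>a\<leftarrow>as. [:- a, 1:])"
    by (simp add: of_real_hom.char_poly_hom[OF B, symmetric] as)
  also have "\<dots> = map_poly complex_of_real (\<Prod>x\<leftarrow>map Re as. [:- x, 1:])"
    using re
  proof (induction as)
    case (Cons a as)
    have "map_poly complex_of_real ([:- Re a, 1:] * q)
        = [:- a, 1:] * map_poly complex_of_real q" for q
      using Cons.prems by (simp only: poly_hom.hom_mult) (simp add: hom_distribs)
    with Cons show ?case by (simp del: mult_pCons_left)
  qed simp
  finally have "char_poly ?B = (\<Prod>x\<leftarrow>map Re as. [:- x, 1:])"
    by (simp only: poly_hom.eq_iff)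
  then show ?thesis using as re by (intro that[of "map Re as"]) auto
qed

lemma singular_values_spec:
  fixes A :: "real mat"
  assumes A: "A \<in> carrier_mat n m"
  shows "size (singular_values A) = n"
    and "\<forall>s\<in>#singular_values A. s \<ge> 0"
    and "char_poly (A * transpose_mat A) = (\<Prod>s\<in>#singular_values A. [:- s\<^sup>2, 1:])"
proof -
  obtain xs where xs: "length xs = n" "\<forall>x\<in>set xs. x \<ge> 0"
    "char_poly (A * transpose_mat A) = (\<Prod>x\<leftarrow>xs. [:- x, 1:])"
    using char_poly_gram_factorized[OF A] .
  have "proots (\<Prod>x\<leftarrow>xs. [:- x, 1:]) = mset xs"
  proof (induction xs)
    case (Cons x xs)
    have "(\<Prod>x\<leftarrow>xs. [:- x, 1:]) \<noteq> 0" by (auto simp: prod_list_zero_iff)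
    with Cons show ?case by (simp add: proots_mult del: mult_pCons_left)
  qed simp
  then have sv: "singular_values A = mset (map sqrt xs)"
    by (simp add: singular_values_def xs(3))
  show "size (singular_values A) = n" "\<forall>s\<in>#singular_values A. s \<ge> 0"
    using xs(1,2) by (auto simp: sv)
  have "map (\<lambda>x. [:- x, 1:]) xs = map (\<lambda>x. [:- (sqrt x)\<^sup>2, 1:]) xs"
    using xs(2) by (intro map_cong) auto
  then have "char_poly (A * transpose_mat A) = (\<Prod>x\<leftarrow>xs. [:- (sqrt x)\<^sup>2, 1:])"
    unfolding xs(3) by (rule arg_cong)
  also have "\<dots> = prod_mset (mset (map (\<lambda>x. [:- (sqrt x)\<^sup>2, 1:]) xs))"
    by (simp only: prod_mset_prod_list)
  finally show "char_poly (A * transpose_mat A) = (\<Prod>s\<in>#singular_values A. [:- s\<^sup>2, 1:])"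
    by (simp add: sv image_mset.compositionality o_def)
qed

end

theory Submission
  imports Defs "Jordan_Normal_Form.Schur_Decomposition"
begin

text \<open>The squares of the singular values of a real matrix \<open>A\<close> are the roots of the characteristic
  polynomial of \<open>A A\<^sup>T\<close>, which splits over the reals; so they add up to the trace of \<open>A A\<^sup>T\<close>, that
  is, to the sum of the squares of all entries of \<open>A\<close> (\<open>sum_squares_singular_values\<close>). In the
  Randic incidence matrix the row of a vertex of degree \<open>d > 0\<close> has exactly \<open>d\<close> nonzero entries,
  each with square \<open>1 / d\<close>, so it contributes \<open>1\<close>; the row of an isolated vertex is zero. Hence
  the squares of the singular values add up to \<open>r\<close>
  (\<open>sum_squares_singular_values_randic_incidence\<close>).

  Since the singular values are nonnegative, the normalizing constant in the weights \<open>p\<^sub>i\<close> is the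
  energy \<open>E\<close>. It is nonzero, because a graph with an edge has \<open>r > 0\<close>. So
  \<open>\<Sum> p\<^sub>i = 1\<close>, \<open>\<Sum> p\<^sub>i\<^sup>2 = r / E\<^sup>2\<close> and \<open>\<Sum> p\<^sub>i\<^sup>\<alpha> = M / E\<^sup>\<alpha>\<close>, and these three power sums turn the
  definitions of the entropies into the claimed formulas.\<close>

lemma sum_list_diag_mat: "sum_list (diag_mat A) = (\<Sum>i<dim_row A. A $$ (i, i))"
  by (simp add: diag_mat_def interv_sum_list_conv_sum_set_nat atLeast0LessThan)

lemma trace_mult_commute:
  fixes A B :: "'a::comm_semiring_0 mat"
  assumes A: "A \<in> carrier_mat n m" and B: "B \<in> carrier_mat m n"
  shows "sum_list (diag_mat (A * B)) = sum_list (diag_mat (B * A))"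
proof -
  have "sum_list (diag_mat (A * B)) = (\<Sum>i<n. \<Sum>j<m. A $$ (i, j) * B $$ (j, i))"
    using A B by (auto simp: sum_list_diag_mat scalar_prod_def atLeast0LessThan intro!: sum.cong)
  also have "\<dots> = (\<Sum>j<m. \<Sum>i<n. B $$ (j, i) * A $$ (i, j))"
    by (subst sum.swap) (simp add: mult.commute)
  also have "\<dots> = sum_list (diag_mat (B * A))"
    using A B by (auto simp: sum_list_diag_mat scalar_prod_def atLeast0LessThan intro!: sum.cong)
  finally show ?thesis .
qed

text \<open>The trace is invariant under the similarity that takes \<open>A\<close> to its Schur form, whose diagonal
  lists the roots.\<close>

lemma trace_eq_sum_roots_char_poly:
  fixes A :: "'a::conjugatable_ordered_field mat"
  assumes A: "A \<in> carrier_mat n n"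
    and roots: "char_poly A = (\<Prod>a\<leftarrow>as. [:- a, 1:])"
  shows "sum_list (diag_mat A) = sum_list as"
proof -
  obtain B P Q where schur: "schur_decomposition A as = (B, P, Q)"
    by (metis prod_cases3)
  from schur_decomposition[OF A roots schur]
  have sim: "similar_mat_wit A B P Q" and diag: "diag_mat B = as" by auto
  note w = similar_mat_witD2[OF A sim]
  have "sum_list (diag_mat A) = sum_list (diag_mat (P * (B * Q)))"
    using w by (simp add: assoc_mult_mat[of P n n B n Q n])
  also have "\<dots> = sum_list (diag_mat ((B * Q) * P))"
    using w by (intro trace_mult_commute) auto
  also have "(B * Q) * P = B * (Q * P)"
    using w by (intro assoc_mult_mat) auto
  also have "\<dots> = B" using w by simp
  finally show ?thesis by (simp add: diag)
qed

lemma trace_gram: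
  fixes A :: "'a::comm_semiring_1 mat"
  assumes A: "A \<in> carrier_mat n m"
  shows "sum_list (diag_mat (A * transpose_mat A)) = (\<Sum>i<n. \<Sum>j<m. (A $$ (i, j))\<^sup>2)"
  using A by (auto simp: sum_list_diag_mat scalar_prod_def power2_eq_square atLeast0LessThan
      intro!: sum.cong)

lemma sum_squares_singular_values:
  fixes A :: "real mat"
  assumes A: "A \<in> carrier_mat n m"
  shows "(\<Sum>s\<in>#singular_values A. s\<^sup>2) = (\<Sum>i<n. \<Sum>j<m. (A $$ (i, j))\<^sup>2)"
proof -
  obtain xs where xs: "singular_values A = mset xs" by (metis ex_mset)
  have "char_poly (A * transpose_mat A) = (\<Prod>s\<in>#mset xs. [:- s\<^sup>2, 1:])"
    using singular_values_spec(3)[OF A] by (simp only: xs)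
  also have "\<dots> = prod_mset (mset (map (\<lambda>s. [:- s\<^sup>2, 1:]) xs))" by (simp only: mset_map)
  also have "\<dots> = (\<Prod>a\<leftarrow>map (\<lambda>s. s\<^sup>2) xs. [:- a, 1:])"
    by (simp only: prod_mset_prod_list map_map o_def)
  finally have "sum_list (diag_mat (A * transpose_mat A)) = (\<Sum>s\<leftarrow>xs. s\<^sup>2)"
    using A by (intro trace_eq_sum_roots_char_poly[of _ n]) auto
  also have "\<dots> = (\<Sum>s\<in>#singular_values A. s\<^sup>2)"
    unfolding xs by (simp only: mset_map[symmetric] sum_mset_sum_list)
  finally show ?thesis using trace_gram[OF A] by simp
qed

lemma vdegree_eq_card_indices:
  assumes "distinct es"
  shows "vdegree es v = card {j. j < length es \<and> v \<in> es ! j}"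
proof -
  have "bij_betw ((!) es) {j. j < length es \<and> v \<in> es ! j} {e \<in> set es. v \<in> e}"
    using assms by (auto simp: bij_betw_def inj_on_def nth_eq_iff_index_eq in_set_conv_nth)
  then show ?thesis unfolding vdegree_def by (metis bij_betw_same_card)
qed

lemma row_sum_squares_randic_incidence:
  assumes es: "distinct es" and i: "i < length vs"
  shows "(\<Sum>j<length es. (randic_incidence_matrix vs es $$ (i, j))\<^sup>2)
    = (if vdegree es (vs ! i) = 0 then 0 else 1)"
proof -
  let ?d = "real (vdegree es (vs ! i))"
  let ?J = "{j. j < length es \<and> vs ! i \<in> es ! j}"
  have "(\<Sum>j<length es. (randic_incidence_matrix vs es $$ (i, j))\<^sup>2)
      = (\<Sum>j<length es. if vs ! i \<in> es ! j then (?d powr (- 1 / 2))\<^sup>2 else 0)"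
    using i by (intro sum.cong) (auto simp: randic_incidence_matrix_def)
  also have "\<dots> = (\<Sum>j\<in>?J. (?d powr (- 1 / 2))\<^sup>2)"
    by (subst sum.inter_filter[symmetric]) auto
  also have "\<dots> = ?d * (?d powr (- 1 / 2))\<^sup>2"
    by (simp add: vdegree_eq_card_indices[OF es])
  also have "(?d powr (- 1 / 2))\<^sup>2 = ?d powr (- 1)"
    by (simp add: power2_eq_square flip: powr_add)
  \<comment> \<open>At an isolated vertex the left side is \<open>0 * 0\<close>, since \<open>0 powr (- 1) = 0\<close>.\<close>
  also have "?d * ?d powr (- 1) = (if vdegree es (vs ! i) = 0 then 0 else 1)"
    by (simp add: powr_minus)
  finally show ?thesis .
qed

lemma sum_squares_singular_values_randic_incidence:
  assumes graph: "simple_graph vs es"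
  shows "(\<Sum>s\<in>#singular_values (randic_incidence_matrix vs es). s\<^sup>2)
    = real (card (set vs - isolated_vertices vs es))"
proof -
  have vs: "distinct vs" and es: "distinct es" using graph by (auto simp: simple_graph_def)
  have "(\<Sum>s\<in>#singular_values (randic_incidence_matrix vs es). s\<^sup>2)
      = (\<Sum>i<length vs. \<Sum>j<length es. (randic_incidence_matrix vs es $$ (i, j))\<^sup>2)"
    by (intro sum_squares_singular_values) (simp add: randic_incidence_matrix_def)
  also have "\<dots> = (\<Sum>i<length vs. if vdegree es (vs ! i) = 0 then 0 else 1)"
    by (simp add: row_sum_squares_randic_incidence[OF es])
  also have "\<dots> = (\<Sum>v\<in>set vs. if vdegree es v = 0 then 0 else 1)"
    by (rule sum.reindex_bij_betw[OF bij_betw_nth]) (use vs in auto)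
  also have "\<dots> = (\<Sum>v\<in>{v \<in> set vs. vdegree es v \<noteq> 0}. 1)"
    by (subst sum.inter_filter) (auto intro!: sum.cong)
  also have "{v \<in> set vs. vdegree es v \<noteq> 0} = set vs - isolated_vertices vs es"
    by (auto simp: isolated_vertices_def)
  finally show ?thesis by simp
qed

lemma card_nonisolated_vertices_pos:
  assumes graph: "simple_graph vs es" and edge: "es \<noteq> []"
  shows "card (set vs - isolated_vertices vs es) > 0"
proof -
  from edge have e: "hd es \<in> set es" by simp
  with graph have sub: "hd es \<subseteq> set vs" and "card (hd es) = 2"
    by (auto simp: simple_graph_def)
  then obtain v where v: "v \<in> hd es" by fastforce
  with e have "vdegree es v > 0" by (auto simp: vdegree_def card_gt_0_iff)
  with v sub have "v \<in> set vs - isolated_vertices vs es"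
    by (auto simp: isolated_vertices_def)
  then show ?thesis by (auto simp: card_gt_0_iff)
qed

text \<open>If all \<open>\<mu> i\<close> vanish, the weights are all \<open>0\<close> and do not add up to \<open>1\<close>; hence the
  hypothesis here.\<close>

lemma entropy1_eq:
  assumes "(\<Sum>i=1..n. \<bar>\<mu> i\<bar>) \<noteq> 0"
  shows "entropy1 n \<mu> = 1 - (\<Sum>i=1..n. (\<mu> i)\<^sup>2) / (\<Sum>i=1..n. \<bar>\<mu> i\<bar>)\<^sup>2"
proof -
  have "entropy1 n \<mu> = (\<Sum>i=1..n. entropy_weight n \<mu> i) - (\<Sum>i=1..n. (entropy_weight n \<mu> i)\<^sup>2)"
    by (simp add: entropy1_def algebra_simps power2_eq_square sum_subtractf)
  also have "(\<Sum>i=1..n. entropy_weight n \<mu> i) = 1"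
    using assms by (simp add: entropy_weight_def flip: sum_divide_distrib)
  also have "(\<Sum>i=1..n. (entropy_weight n \<mu> i)\<^sup>2)
      = (\<Sum>i=1..n. (\<mu> i)\<^sup>2) / (\<Sum>i=1..n. \<bar>\<mu> i\<bar>)\<^sup>2"
    by (simp add: entropy_weight_def power_divide sum_divide_distrib)
  finally show ?thesis .
qed

lemma sum_entropy_weight_powr:
  "(\<Sum>i=1..n. entropy_weight n \<mu> i powr \<alpha>)
    = (\<Sum>i=1..n. \<bar>\<mu> i\<bar> powr \<alpha>) / (\<Sum>i=1..n. \<bar>\<mu> i\<bar>) powr \<alpha>"
  by (simp add: entropy_weight_def powr_divide sum_nonneg sum_divide_distrib)

theorem theorem3p13:
  fixes vs :: "'a list" and es :: "'a set list" and n m r :: nat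
    and U W :: "'a set" and \<sigma> :: "nat \<Rightarrow> real" and \<alpha> b M E :: real
  assumes graph: "simple_graph vs es"
    and n: "n = length vs" and m: "m = length es"
    and edge: "m \<ge> 1"
    and U: "U = isolated_vertices vs es"
    and W: "W = set vs - U"
    and r: "r = card W"
    and sigma: "image_mset \<sigma> (mset_set {1..n}) = singular_values (randic_incidence_matrix vs es)"
    and E: "E = randic_incidence_energy vs es"
    and M: "M = (\<Sum>i=1..n. \<bar>\<sigma> i\<bar> powr \<alpha>)"
    and alpha: "\<alpha> \<noteq> 1"
    and base: "b > 0" "b \<noteq> 1"
  shows "entropy1 n \<sigma> = 1 - real r / E\<^sup>2
    \<and> entropy2 b \<alpha> n \<sigma> = 1 / (1 - \<alpha>) * log b (M / E powr \<alpha>)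
    \<and> entropy3 \<alpha> n \<sigma> = 1 / (2 powr (1 - \<alpha>) - 1) * (M / E powr \<alpha> - 1)"
proof -
  let ?A = "randic_incidence_matrix vs es"
  have A: "?A \<in> carrier_mat n m" by (simp add: randic_incidence_matrix_def n m)
  have image_sum: "(\<Sum>s\<in>#singular_values ?A. f s) = (\<Sum>i=1..n. f (\<sigma> i))" for f :: "real \<Rightarrow> real"
    unfolding sigma[symmetric] by (simp add: image_mset.compositionality o_def sum_unfold_sum_mset)
  have nonneg: "\<sigma> i \<ge> 0" if "i \<in> {1..n}" for i
  proof -
    have "\<sigma> i \<in># singular_values ?A" unfolding sigma[symmetric] using that by simp
    then show ?thesis using singular_values_spec(2)[OF A] by blast
  qed
  have sumE: "(\<Sum>i=1..n. \<bar>\<sigma> i\<bar>) = E"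
    using nonneg image_sum[of "\<lambda>s. s"] by (simp add: E randic_incidence_energy_def)
  have squares: "(\<Sum>i=1..n. (\<sigma> i)\<^sup>2) = real r"
    using sum_squares_singular_values_randic_incidence[OF graph] by (simp add: image_sum r W U)
  have "r > 0" using card_nonisolated_vertices_pos[OF graph] edge m by (force simp: r W U)
  have "E \<noteq> 0"
  proof
    assume "E = 0"
    then have "\<forall>i\<in>{1..n}. \<sigma> i = 0"
      using sumE by (simp add: sum_nonneg_eq_0_iff)
    then have "(\<Sum>i=1..n. (\<sigma> i)\<^sup>2) = 0" by simp
    with squares \<open>r > 0\<close> show False by simp
  qed
  then show ?thesis
    using entropy1_eq[of \<sigma> n]
    by (simp add: entropy2_def entropy3_def sum_entropy_weight_powr sumE squares M
        del: One_nat_def)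
qed

end
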